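(* Let $Q(x,y,z)=ax^2+by^2+cz^2$, where $a,b,c$ are positive integers with $\gcd(a,b,c)=1$. For each prime $p$, the coefficients are labeled according to the labeling convention given in the context. Then the following hold. For an odd prime $p$, with $\left(\frac{\cdot}{p}\right)$ the Legendre symbol, \[ \epsilon_{Q,p}=\begin{cases}1 & \text{if }p\text{ divides exactly two of the integers }a,b,c,\\ 2 & \text{if }p\text{ divides exactly one of the integers }a,b,c\text{ and }\left(\frac{-bc}{p}\right)=-1,\\ \infty & \text{if }p\nmid abc,\text{ or }p\text{ divides exactly one of the integers }a,b,c\text{ and }\left(\frac{-bc}{p}\right)=1.\end{cases} \] For $p=2$: (1) If all of $a,b,c$ are odd, \[ \epsilon_{Q,2}=\begin{cases}3 & \text{if }a\equiv b\equiv c\pmod4,\\ \infty & \text{otherwise}.\end{cases} \] (2) If $a,b$ are even and $c$ is odd, \[ \epsilon_{Q,2}=\begin{cases}2 & \text{if }4\mid a\text{ and }4\mid b,\\ 3 & \text{if }a\equiv b\equiv2\pmod4,\text{ or }a\equiv2\pmod4\text{ and }b\equiv0\pmod8,\\ 4 & \text{if }a\equiv2\pmod4\text{ and }b\equiv4\pmod8.\end{cases} \] (3) If $a$ is even and $b,c$ are odd, \[ \epsilon_{Q,2}=\begin{cases}2 & \text{if }4\mid a,\\ \infty & \text{if }a\equiv2\pmod4\text{ and }a+b+c\equiv0\pmod8,\text{ or }a\equiv2\pmod4\text{ and }b+c\equiv0\pmod8,\\ 4 & \text{otherwise}.\end{cases} \]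
   Context: For $l\in\mathbb{Z}$ and $k\in\mathbb{Z}_{\ge1}$, write $Q\not\equiv l\pmod k$ if $Q(x,y,z)\not\equiv l\pmod k$ for all $(x,y,z)\in\mathbb{Z}^3$. We say $Q$ has a local obstruction modulo $k$ if there exists $l\in\mathbb{Z}$ with $Q\not\equiv l\pmod k$. For a prime $p$, $\epsilon_{Q,p}:=\min\{e\in\mathbb{Z}_{\ge1}\mid Q\text{ has a local obstruction modulo }p^e\}$, with $\epsilon_{Q,p}=\infty$ if $Q$ has no local obstruction modulo $p^e$ for any $e$. Labeling convention (permuting the variables does not change $\epsilon_{Q,p}$): for an odd prime $p$ dividing exactly one of the coefficients, the coefficients are labeled so that $p\mid a$. For $p=2$: if exactly two coefficients are even they are labeled $a,b$, ordered so that $a\equiv2\pmod4$ whenever exactly one of them is $\equiv2\pmod4$; if exactly one coefficient is even it is called $a$. With this convention the case distinctions are exhaustive. *)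

theory Defs
  imports "HOL-Number_Theory.Number_Theory" "HOL-Library.Multiset" "HOL-Library.Extended_Nat"
begin

definition diag_form :: "int \<Rightarrow> int \<Rightarrow> int \<Rightarrow> int \<Rightarrow> int \<Rightarrow> int \<Rightarrow> int" where
  "diag_form a b c x y z = a * x^2 + b * y^2 + c * z^2"

definition local_obstruction :: "(int \<Rightarrow> int \<Rightarrow> int \<Rightarrow> int) \<Rightarrow> int \<Rightarrow> bool" where
  "local_obstruction Q k \<longleftrightarrow> (\<exists>l. \<forall>x y z. \<not> [Q x y z = l] (mod k))"

definition eps :: "(int \<Rightarrow> int \<Rightarrow> int \<Rightarrow> int) \<Rightarrow> int \<Rightarrow> enat" where
  "eps Q p =
     (if \<exists>e\<ge>1. local_obstruction Q (p ^ e)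
      then enat (LEAST e. e \<ge> 1 \<and> local_obstruction Q (p ^ e))
      else \<infinity>)"

text \<open>How many of the three coefficients are divisible by \<open>p\<close>, counted with repetition
  when some of them coincide.\<close>

definition num_divisible :: "int \<Rightarrow> int \<Rightarrow> int \<Rightarrow> int \<Rightarrow> nat" where
  "num_divisible p a b c = size {#t \<in># {#a, b, c#}. p dvd t#}"

text \<open>The labelling may differ from prime to prime. The order is left free in all cases not
  mentioned; \<open>labelling_exists\<close> shows that the condition can always be met.\<close>

definition labelled :: "int \<Rightarrow> int \<Rightarrow> int \<Rightarrow> int \<Rightarrow> bool" where
  "labelled p a b c \<longleftrightarrow>
     (if p = 2
      then (num_divisible 2 a b c = 2 \<longrightarrow>
              even a \<and> even b \<and>
              (([a = 2] (mod 4)) \<noteq> ([b = 2] (mod 4)) \<longrightarrow> [a = 2] (mod 4))) \<and>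
           (num_divisible 2 a b c = 1 \<longrightarrow> even a)
      else num_divisible p a b c = 1 \<longrightarrow> p dvd a)"

lemma labelling_exists:
  "\<exists>a b c. {#a, b, c#} = {#a\<^sub>0, b\<^sub>0, c\<^sub>0#} \<and> labelled p a b c"
proof -
  have P: "{#a\<^sub>0, b\<^sub>0, c\<^sub>0#} = {#a\<^sub>0, b\<^sub>0, c\<^sub>0#}" "{#a\<^sub>0, c\<^sub>0, b\<^sub>0#} = {#a\<^sub>0, b\<^sub>0, c\<^sub>0#}"
    "{#b\<^sub>0, a\<^sub>0, c\<^sub>0#} = {#a\<^sub>0, b\<^sub>0, c\<^sub>0#}" "{#b\<^sub>0, c\<^sub>0, a\<^sub>0#} = {#a\<^sub>0, b\<^sub>0, c\<^sub>0#}"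
    "{#c\<^sub>0, a\<^sub>0, b\<^sub>0#} = {#a\<^sub>0, b\<^sub>0, c\<^sub>0#}" "{#c\<^sub>0, b\<^sub>0, a\<^sub>0#} = {#a\<^sub>0, b\<^sub>0, c\<^sub>0#}"
    by (auto simp: add_mset_commute)
  have "labelled p a\<^sub>0 b\<^sub>0 c\<^sub>0 \<or> labelled p a\<^sub>0 c\<^sub>0 b\<^sub>0 \<or> labelled p b\<^sub>0 a\<^sub>0 c\<^sub>0 \<or>
        labelled p b\<^sub>0 c\<^sub>0 a\<^sub>0 \<or> labelled p c\<^sub>0 a\<^sub>0 b\<^sub>0 \<or> labelled p c\<^sub>0 b\<^sub>0 a\<^sub>0"
    by (cases "p dvd a\<^sub>0"; cases "p dvd b\<^sub>0"; cases "p dvd c\<^sub>0"; cases "p = 2";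
        simp add: labelled_def num_divisible_def; blast)
  with P show ?thesis by blast
qed

end

theory Submission imports Defs begin

text \<open>Hensel lifting shows that there is no obstruction modulo any power of \<open>p\<close>: a solution modulo
  \<open>p\<close> (modulo 8 if \<open>p = 2\<close>) in which some variable and its coefficient are both units lifts to
  all powers of \<open>p\<close>; for \<open>p = 2\<close> a unit variable with a coefficient congruent to 2 modulo 4 lifts
  from modulo 16. For odd \<open>p\<close> the pigeonhole principle provides such a solution, while
  obstructions come from the fact that \<open>t * x\<^sup>2\<close> never takes all values modulo \<open>p\<close>. For \<open>p = 2\<close>
  only residues modulo 16 matter, so that obstructions and liftable solutions are found by a
  finite search.\<close>

section \<open>Local obstructions\<close>

definition represented :: "(int \<Rightarrow> int \<Rightarrow> int \<Rightarrow> int) \<Rightarrow> int \<Rightarrow> int \<Rightarrow> bool" where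
  "represented Q k l \<longleftrightarrow> (\<exists>x y z. [Q x y z = l] (mod k))"

lemma local_obstruction_iff: "local_obstruction Q k \<longleftrightarrow> (\<exists>l. \<not> represented Q k l)"
  by (auto simp: local_obstruction_def represented_def)

lemma representedI: "[Q x y z = l] (mod k) \<Longrightarrow> represented Q k l"
  by (auto simp: represented_def)

text \<open>The two transpositions generate all permutations of the coefficients.\<close>

lemma represented_perm:
  "represented (diag_form a b c) k l \<longleftrightarrow> represented (diag_form b a c) k l"
  "represented (diag_form a b c) k l \<longleftrightarrow> represented (diag_form a c b) k l"
proof -
  have "diag_form a b c x y z = diag_form b a c y x z"
       "diag_form a b c x y z = diag_form a c b x z y" for a b c x y z
    by (simp_all add: diag_form_def)
  then show "represented (diag_form a b c) k l \<longleftrightarrow> represented (diag_form b a c) k l"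
      "represented (diag_form a b c) k l \<longleftrightarrow> represented (diag_form a c b) k l"
    unfolding represented_def by metis+
qed

lemma eps_perm: "eps (diag_form a b c) p = eps (diag_form b a c) p"
    "eps (diag_form a b c) p = eps (diag_form a c b) p"
proof -
  have "represented (diag_form a b c) = represented (diag_form b a c)"
       "represented (diag_form a b c) = represented (diag_form a c b)"
    by (intro ext; rule represented_perm)+
  then show "eps (diag_form a b c) p = eps (diag_form b a c) p"
      "eps (diag_form a b c) p = eps (diag_form a c b) p"
    by (simp_all add: eps_def local_obstruction_iff)
qed

text \<open>Carries values computed for the labelled coefficients back to the original ones.\<close>

lemma eps_mset_cong:
  assumes "{#a, b, c#} = {#a', b', c'#}"
  shows "eps (diag_form a b c) p = eps (diag_form a' b' c') p"
proof -
  have "(a, b, c) \<in> {(a', b', c'), (a', c', b'), (b', a', c'), (b', c', a'), (c', a', b'), (c', b', a')}"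
    using assms by (auto simp: add_eq_conv_ex)
  then show ?thesis by (elim insertE emptyE; clarify; metis eps_perm)
qed

lemma local_obstruction_mono:
  assumes "local_obstruction Q k" "k dvd m"
  shows "local_obstruction Q m"
  using assms unfolding local_obstruction_def by (meson cong_dvd_modulus)

text \<open>Obstructions persist to larger exponents, so a change between \<open>n\<close> and
  \<open>Suc n\<close> locates the minimum. For \<open>n = 0\<close> the modulus is 1, which never
  obstructs.\<close>

lemma eps_eq_SucI:
  assumes "local_obstruction Q (p ^ Suc n)" "\<not> local_obstruction Q (p ^ n)"
  shows "eps Q p = enat (Suc n)"
proof -
  have "(LEAST e. e \<ge> 1 \<and> local_obstruction Q (p ^ e)) = Suc n"
  proof (rule Least_equality)
    show "1 \<le> Suc n \<and> local_obstruction Q (p ^ Suc n)" using assms by simp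
  next
    fix e assume e: "1 \<le> e \<and> local_obstruction Q (p ^ e)"
    show "Suc n \<le> e"
    proof (rule ccontr)
      assume "\<not> Suc n \<le> e"
      then have "p ^ e dvd p ^ n" by (simp add: le_imp_power_dvd)
      then show False using e local_obstruction_mono assms(2) by blast
    qed
  qed
  moreover have "\<exists>e\<ge>1. local_obstruction Q (p ^ e)"
    using assms(1) by (intro exI[of _ "Suc n"]) simp
  ultimately show ?thesis by (simp add: eps_def)
qed

lemma eps_eq_infinityI:
  assumes "\<And>e l. represented Q (p ^ e) l"
  shows "eps Q p = \<infinity>"
  using assms by (simp add: eps_def local_obstruction_iff)

section \<open>Odd primes\<close>

text \<open>Since \<open>p\<close> is odd, the derivative \<open>2 * t * y\<close> is a unit modulo
  \<open>p\<close>, so each Newton step gains one factor \<open>p\<close> and keeps \<open>y\<close>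
  a unit.\<close>

lemma hensel_square:
  fixes p t s u :: int
  assumes p: "prime p" "odd p" and ts: "\<not> p dvd t" "\<not> p dvd s" and "[t * s\<^sup>2 = u] (mod p)"
  shows "\<exists>y. [t * y\<^sup>2 = u] (mod p ^ e)"
proof (cases e)
  case (Suc n)
  have "\<exists>y. [t * y\<^sup>2 = u] (mod p ^ Suc n) \<and> \<not> p dvd y"
  proof (induction n)
    case 0
    then show ?case using assms by auto
  next
    case (Suc n)
    then obtain y where y: "[t * y\<^sup>2 = u] (mod p ^ Suc n)" "\<not> p dvd y" by blast
    obtain q where q: "t * y\<^sup>2 - u = p ^ Suc n * q"
      using y(1) by (auto simp: cong_iff_dvd_diff dvd_def)
    have "\<not> p dvd 2"
      using p prime_ge_2_int[of p] zdvd_imp_le[of p 2] by (cases "p = 2") auto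
    then have "\<not> p dvd 2 * t * y"
      using p ts y by (simp add: prime_dvd_mult_iff)
    then have "coprime (2 * t * y) p"
      using p prime_imp_coprime coprime_commute by blast
    then obtain i where i: "[2 * t * y * i = 1] (mod p)"
      using cong_solve_coprime_int by blast
    \<comment> \<open>As \<open>i\<close> inverts \<open>2 * t * y\<close>, this \<open>k\<close>
      makes the new linear term cancel the quotient \<open>q\<close> modulo
      \<open>p\<close>.\<close>
    define k where "k = - q * i"
    have "[q + 2 * t * y * k = q + (- q) * (2 * t * y * i)] (mod p)"
      by (simp add: k_def algebra_simps)
    also have "[q + (- q) * (2 * t * y * i) = q + (- q) * 1] (mod p)"
      using i by (intro cong_add cong_mult cong_refl)
    finally obtain r where r: "q + 2 * t * y * k = p * r"
      by (auto simp: cong_0_iff)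
    have "t * (y + k * p ^ Suc n)\<^sup>2 - u = p ^ Suc n * (q + 2 * t * y * k + t * k\<^sup>2 * p ^ Suc n)"
      using q by (simp add: power2_eq_square algebra_simps)
    also have "\<dots> = p ^ Suc (Suc n) * (r + t * k\<^sup>2 * p ^ n)"
      unfolding r by (simp add: algebra_simps)
    finally have "[t * (y + k * p ^ Suc n)\<^sup>2 = u] (mod p ^ Suc (Suc n))"
      by (simp add: cong_iff_dvd_diff)
    moreover have "\<not> p dvd y + k * p ^ Suc n"
      using y(2) by (simp add: dvd_add_left_iff)
    ultimately show ?case by blast
  qed
  then show ?thesis using Suc by blast
\<comment> \<open>The remaining case is \<open>e = 0\<close>, with modulus 1.\<close>
qed (simp add: cong_def)

lemma represented_odd_lift:
  fixes p :: int
  assumes "prime p" "odd p" "\<not> p dvd c" "\<not> p dvd z" "[diag_form a b c x y z = l] (mod p)"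
  shows "represented (diag_form a b c) (p ^ e) l"
proof -
  have "[c * z\<^sup>2 = l - a * x\<^sup>2 - b * y\<^sup>2] (mod p)"
    using assms(5) by (simp add: cong_iff_dvd_diff diag_form_def algebra_simps)
  from hensel_square[OF assms(1-4) this, of e] obtain w
    where "[c * w\<^sup>2 = l - a * x\<^sup>2 - b * y\<^sup>2] (mod p ^ e)" by blast
  then have "[diag_form a b c x y w = l] (mod p ^ e)"
    by (simp add: cong_iff_dvd_diff diag_form_def algebra_simps)
  then show ?thesis by (rule representedI)
qed

section \<open>Values of scaled squares and binary forms modulo an odd prime\<close>

text \<open>A surjection of the residues onto themselves would be injective, yet 1 and
  \<open>p - 1\<close> have the same square. Here \<open>t\<close> may be a multiple of
  \<open>p\<close>, as happens below for \<open>a'\<close> when \<open>p^2\<close> divides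
  \<open>a\<close>.\<close>

lemma scaled_square_not_surj:
  fixes p t :: int
  assumes "prime p" "odd p"
  shows "\<exists>m. \<forall>x. \<not> [t * x\<^sup>2 = m] (mod p)"
proof (rule ccontr)
  assume "\<not> ?thesis"
  then have *: "\<exists>x. [t * x\<^sup>2 = m] (mod p)" for m by blast
  have p: "p > 2" using assms prime_ge_2_int[of p] by (cases "p = 2") auto
  let ?f = "\<lambda>x. (t * x\<^sup>2) mod p"
  have "{0..<p} \<subseteq> ?f ` {0..<p}"
  proof
    fix m assume m: "m \<in> {0..<p}"
    obtain x where "[t * x\<^sup>2 = m] (mod p)" using * by blast
    then have "m = ?f x" using m by (simp add: cong_def)
    also have "\<dots> = ?f (x mod p)" by (metis mod_mult_right_eq power_mod)
    finally show "m \<in> ?f ` {0..<p}" using p by (intro image_eqI[of _ _ "x mod p"]) auto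
  qed
  moreover have "?f ` {0..<p} \<subseteq> {0..<p}" using p by auto
  ultimately have "inj_on ?f {0..<p}"
    by (intro eq_card_imp_inj_on) (simp_all add: subset_antisym)
  moreover have "?f 1 = ?f (p - 1)"
  proof -
    have "t * (p - 1)\<^sup>2 = t * 1\<^sup>2 + p * (t * (p - 2))"
      by (simp add: power2_eq_square algebra_simps)
    then show ?thesis by (metis mod_mult_self2)
  qed
  ultimately have "1 = p - 1"
    by (rule inj_onD) (use p in auto)
  then show False using p by simp
qed

text \<open>\<open>p\<close> divides \<open>x + y\<close> or \<open>x - y\<close>, and both are
  smaller than \<open>p\<close> in absolute value.\<close>

lemma scaled_square_inj:
  fixes p b :: int
  assumes "prime p" "\<not> p dvd b" "[b * x\<^sup>2 = b * y\<^sup>2] (mod p)"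
    "0 \<le> x" "0 \<le> y" "2 * x < p" "2 * y < p"
  shows "x = y"
proof -
  have "p dvd b * ((x + y) * (x - y))"
    using assms(3) by (simp add: cong_iff_dvd_diff power2_eq_square algebra_simps)
  then have "p dvd x + y \<or> p dvd x - y"
    using assms by (simp add: prime_dvd_mult_iff)
  then show ?thesis
  proof
    assume "p dvd x + y"
    then show ?thesis using assms zdvd_imp_le[of p "x + y"] by (cases "x + y = 0") auto
  next
    assume "p dvd x - y"
    then show ?thesis using assms dvd_imp_le_int[of "x - y" p] by (cases "x - y = 0") auto
  qed
qed

text \<open>Pigeonhole: \<open>b * y^2\<close> and \<open>l - c * z^2\<close> each take
  \<open>(p + 1) / 2\<close> distinct values on \<open>S\<close>, too many to be disjoint among
  \<open>p\<close> residues.\<close>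

lemma binary_form_surj:
  fixes p b c l :: int
  assumes "prime p" "odd p" "\<not> p dvd b" "\<not> p dvd c"
  shows "\<exists>y z. [b * y\<^sup>2 + c * z\<^sup>2 = l] (mod p)"
proof (rule ccontr)
  assume no: "\<not> ?thesis"
  \<comment> \<open>One representative of each residue up to sign.\<close>
  define S where "S = {0..p div 2}"
  let ?f = "\<lambda>y. (b * y\<^sup>2) mod p" and ?g = "\<lambda>z. (l - c * z\<^sup>2) mod p"
  have p: "p > 2" using assms prime_ge_2_int[of p] by (cases "p = 2") auto
  have S: "0 \<le> x \<and> 2 * x < p" if "x \<in> S" for x using that assms(2) unfolding S_def by auto presburger
  have "inj_on ?f S"
    by (rule inj_onI) (use S scaled_square_inj assms in \<open>metis cong_def\<close>)
  moreover have "inj_on ?g S"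
  proof (rule inj_onI)
    fix x y assume xy: "x \<in> S" "y \<in> S" "?g x = ?g y"
    then have "p dvd (l - c * x\<^sup>2) - (l - c * y\<^sup>2)" by (simp only: mod_eq_dvd_iff)
    then have "[c * x\<^sup>2 = c * y\<^sup>2] (mod p)"
      by (simp add: cong_iff_dvd_diff dvd_diff_commute)
    then show "x = y" using S xy scaled_square_inj assms by metis
  qed
  moreover have "?f ` S \<inter> ?g ` S = {}"
  proof -
    have "?f y \<noteq> ?g z" for y z
    proof
      assume "?f y = ?g z"
      then have "[b * y\<^sup>2 + c * z\<^sup>2 = l] (mod p)"
        by (simp add: mod_eq_dvd_iff cong_iff_dvd_diff algebra_simps)
      then show False using no by blast
    qed
    then show ?thesis by auto
  qed
  moreover have "card (?f ` S \<union> ?g ` S) \<le> card {0..<p}"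
    using p by (intro card_mono) auto
  ultimately have "2 * card S \<le> nat p"
    by (simp add: card_Un_disjoint card_image S_def)
  then show False using p assms(2) unfolding S_def by (simp; presburger)
qed

text \<open>A zero with \<open>z\<close> a unit would make \<open>- b * c\<close> a square modulo
  \<open>p\<close>. Once \<open>p\<close> divides \<open>z\<close>, it divides \<open>y\<close>
  because \<open>b\<close> is a unit.\<close>

lemma binary_form_anisotropic:
  fixes p b c :: int
  assumes p: "prime p" and Leg: "Legendre (- b * c) p = -1" and yz: "[b * y\<^sup>2 + c * z\<^sup>2 = 0] (mod p)"
  shows "p dvd y \<and> p dvd z"
proof -
  have nq: "\<not> QuadRes p (- b * c)" and nd: "\<not> p dvd b * c"
    using Leg by (auto simp: Legendre_def cong_0_iff split: if_splits)
  have z: "p dvd z"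
  proof (rule ccontr)
    assume "\<not> p dvd z"
    then have "coprime z p" using p by (simp add: prime_imp_coprime coprime_commute)
    then obtain i where i: "[z * i = 1] (mod p)" using cong_solve_coprime_int by blast
    \<comment> \<open>With \<open>i\<close> the inverse of \<open>z\<close>, the number
      \<open>b * y * i\<close> is a square root of \<open>- b * c\<close> modulo
      \<open>p\<close>.\<close>
    have "[(b * y * i)\<^sup>2 = b * i\<^sup>2 * (b * y\<^sup>2 + c * z\<^sup>2) + (- b * c) * (z * i)\<^sup>2] (mod p)"
      by (simp add: power2_eq_square algebra_simps)
    also have "[b * i\<^sup>2 * (b * y\<^sup>2 + c * z\<^sup>2) + (- b * c) * (z * i)\<^sup>2 = b * i\<^sup>2 * 0 + (- b * c) * 1\<^sup>2] (mod p)"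
      using yz i by (intro cong_add cong_mult cong_pow cong_refl)
    finally have "QuadRes p (- b * c)" by (auto simp: QuadRes_def)
    then show False using nq by blast
  qed
  then have "p dvd b * y\<^sup>2"
    using yz by (simp add: cong_0_iff dvd_add_left_iff power2_eq_square)
  then show ?thesis using z nd p by (auto simp: prime_dvd_mult_iff prime_dvd_power_iff)
qed

section \<open>The value of \<open>eps\<close> at odd primes\<close>

lemma eps_odd_two_divisible:
  fixes p :: int
  assumes "prime p" "odd p" "p dvd a" "p dvd b"
  shows "eps (diag_form a b c) p = 1"
proof -
  obtain m where m: "\<And>z. \<not> [c * z\<^sup>2 = m] (mod p)"
    using scaled_square_not_surj assms by metis
  have "[diag_form a b c x y z = c * z\<^sup>2] (mod p)" for x y z
    using assms by (simp add: cong_iff_dvd_diff diag_form_def)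
  then have "local_obstruction (diag_form a b c) (p ^ Suc 0)"
    using m unfolding local_obstruction_def by (metis cong_sym cong_trans power_one_right One_nat_def)
  moreover have "\<not> local_obstruction (diag_form a b c) (p ^ 0)"
    by (simp add: local_obstruction_def)
  ultimately show ?thesis using eps_eq_SucI by (metis One_nat_def one_enat_def)
qed

text \<open>The class missed modulo \<open>p^2\<close> is \<open>p * m\<close>, where
  \<open>a' * x^2\<close> misses \<open>m\<close> modulo \<open>p\<close>: such a value would force
  \<open>p\<close> to divide \<open>y\<close> and \<open>z\<close>, and dividing by \<open>p\<close>
  would leave \<open>a' * x^2 = m\<close> modulo \<open>p\<close>. Modulo \<open>p\<close> itself,
  \<open>b * y^2 + c * z^2\<close> takes all values.\<close>

lemma eps_odd_anisotropic:
  fixes p :: int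
  assumes p: "prime p" "odd p" and "p dvd a" and Leg: "Legendre (- b * c) p = -1"
  shows "eps (diag_form a b c) p = 2"
proof -
  have nd: "\<not> p dvd b" "\<not> p dvd c"
    using Leg by (auto simp: Legendre_def cong_0_iff split: if_splits)
  obtain a' where a': "a = p * a'" using \<open>p dvd a\<close> by blast
  obtain m where m: "\<And>x. \<not> [a' * x\<^sup>2 = m] (mod p)"
    using scaled_square_not_surj p by metis
  have "\<not> [diag_form a b c x y z = p * m] (mod p ^ Suc 1)" for x y z
  proof
    assume *: "[diag_form a b c x y z = p * m] (mod p ^ Suc 1)"
    then have "[diag_form a b c x y z = p * m] (mod p)"
      by (rule cong_dvd_modulus) simp
    then have "p dvd (b * y\<^sup>2 + c * z\<^sup>2) + p * (a' * x\<^sup>2 - m)"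
      by (simp add: cong_iff_dvd_diff diag_form_def a' algebra_simps)
    then have "[b * y\<^sup>2 + c * z\<^sup>2 = 0] (mod p)"
      by (simp add: cong_0_iff dvd_add_left_iff)
    then obtain y' z' where yz: "y = p * y'" "z = p * z'"
      using binary_form_anisotropic[OF p(1) Leg] by blast
    have "p * p dvd p * (a' * x\<^sup>2 - m) + p * p * (b * y'\<^sup>2 + c * z'\<^sup>2)"
      using * by (simp add: cong_iff_dvd_diff diag_form_def a' yz power2_eq_square algebra_simps)
    then have "p * p dvd p * (a' * x\<^sup>2 - m)" by (simp add: dvd_add_left_iff)
    then have "p dvd a' * x\<^sup>2 - m" using p by auto
    then show False using m by (simp add: cong_iff_dvd_diff)
  qed
  then have "local_obstruction (diag_form a b c) (p ^ Suc 1)"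
    unfolding local_obstruction_def by blast
  moreover have "\<not> local_obstruction (diag_form a b c) (p ^ 1)"
  proof -
    have "represented (diag_form a b c) p l" for l
    proof -
      obtain y z where "[b * y\<^sup>2 + c * z\<^sup>2 = l] (mod p)"
        using binary_form_surj p nd by blast
      then have "[diag_form a b c 0 y z = l] (mod p)" by (simp add: diag_form_def)
      then show ?thesis by (rule representedI)
    qed
    then show ?thesis by (simp add: local_obstruction_iff)
  qed
  ultimately show ?thesis using eps_eq_SucI by (metis numeral_2_eq_2 One_nat_def numeral_eq_enat)
qed

text \<open>If \<open>l - a * x^2\<close> is a unit, a solution of the remaining binary congruence
  has \<open>y\<close> or \<open>z\<close> prime to \<open>p\<close>, and that variable
  lifts.\<close>

lemma represented_odd_unit:
  fixes p :: int
  assumes p: "prime p" "odd p" and nd: "\<not> p dvd b" "\<not> p dvd c" and u: "\<not> p dvd l - a * x\<^sup>2"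
  shows "represented (diag_form a b c) (p ^ e) l"
proof -
  obtain y z where yz: "[b * y\<^sup>2 + c * z\<^sup>2 = l - a * x\<^sup>2] (mod p)"
    using binary_form_surj p nd by blast
  then have c: "[diag_form a b c x y z = l] (mod p)"
    by (simp add: cong_iff_dvd_diff diag_form_def algebra_simps)
  have "\<not> p dvd b * y\<^sup>2 + c * z\<^sup>2"
    using u yz by (simp add: cong_dvd_iff)
  then have "\<not> p dvd y \<or> \<not> p dvd z" by (auto simp: power2_eq_square)
  then show ?thesis
  proof
    assume "\<not> p dvd z"
    then show ?thesis using represented_odd_lift p nd c by blast
  next
    assume "\<not> p dvd y"
    moreover have "[diag_form a c b x z y = l] (mod p)"
      using c by (simp add: diag_form_def algebra_simps)
    ultimately show ?thesis
      using represented_odd_lift[OF p nd(1), of y a c x z l e] represented_perm(2) by blast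
  qed
qed

lemma eps_odd_unit:
  fixes p :: int
  assumes p: "prime p" "odd p" and nd: "\<not> p dvd a" "\<not> p dvd b" "\<not> p dvd c"
  shows "eps (diag_form a b c) p = \<infinity>"
proof (rule eps_eq_infinityI)
  fix e l
  \<comment> \<open>\<open>p\<close> cannot divide both \<open>l\<close> and \<open>l - a\<close>,
    so \<open>x = 0\<close> or \<open>x = 1\<close> works.\<close>
  have "\<not> p dvd l - a * 0\<^sup>2 \<or> \<not> p dvd l - a * 1\<^sup>2"
    using nd(1) dvd_diff[of p l "l - a"] by auto
  then show "represented (diag_form a b c) (p ^ e) l"
    using represented_odd_unit[OF p nd(2,3)] by blast
qed

text \<open>Units \<open>l\<close> are reached with \<open>x = 0\<close>. If \<open>p\<close>
  divides \<open>l\<close>, the point \<open>(0, s, b)\<close> with \<open>s^2 = - b * c\<close>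
  modulo \<open>p\<close> is a zero whose last coordinate is a unit, so it lifts.\<close>

lemma eps_odd_isotropic:
  fixes p :: int
  assumes p: "prime p" "odd p" and "p dvd a" and Leg: "Legendre (- b * c) p = 1"
  shows "eps (diag_form a b c) p = \<infinity>"
proof (rule eps_eq_infinityI)
  fix e l
  have nd: "\<not> p dvd b" "\<not> p dvd c" and "QuadRes p (- b * c)"
    using Leg by (auto simp: Legendre_def cong_0_iff split: if_splits)
  then obtain s where s: "[s\<^sup>2 = - b * c] (mod p)" by (auto simp: QuadRes_def)
  show "represented (diag_form a b c) (p ^ e) l"
  proof (cases "p dvd l")
    case False
    then show ?thesis using represented_odd_unit[OF p nd, of l a 0] by simp
  next
    case True
    have "[b * s\<^sup>2 + c * b\<^sup>2 = b * (- b * c) + c * b\<^sup>2] (mod p)"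
      using s by (intro cong_add cong_mult cong_refl)
    then have "p dvd b * s\<^sup>2 + c * b\<^sup>2"
      by (simp add: cong_iff_dvd_diff power2_eq_square algebra_simps)
    then have "[diag_form a b c 0 s b = l] (mod p)"
      using True by (simp add: cong_iff_dvd_diff diag_form_def)
    then show ?thesis using represented_odd_lift p nd by blast
  qed
qed

section \<open>The prime 2\<close>

text \<open>The derivative is even, so \<open>y\<close> is corrected by
  \<open>q * 2 ^ (n + 2)\<close>, a multiple of half the current modulus. Up to an even term this
  turns the quotient \<open>q\<close> into \<open>q * (1 + t * y)\<close>, which is even because
  \<open>t * y\<close> is odd.\<close>

lemma hensel_square_2:
  fixes t s u :: int
  assumes "odd t" "odd s" "[t * s\<^sup>2 = u] (mod 8)"
  shows "\<exists>y. [t * y\<^sup>2 = u] (mod 2 ^ e)"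
proof -
  \<comment> \<open>The shift by 3 starts the induction at modulus 8; smaller powers follow by
    divisibility.\<close>
  have "\<exists>y. odd y \<and> [t * y\<^sup>2 = u] (mod 2 ^ (e + 3))"
  proof (induction e)
    case 0
    then show ?case using assms by auto
  next
    case (Suc n)
    then obtain y where y: "odd y" "[t * y\<^sup>2 = u] (mod 2 ^ (n + 3))" by blast
    obtain q where q: "t * y\<^sup>2 - u = 2 ^ (n + 3) * q"
      using y(2) by (auto simp: cong_iff_dvd_diff dvd_def)
    have "even (q * (1 + t * y))" using y(1) assms(1) by simp
    then obtain r where r: "q * (1 + t * y) = 2 * r" by blast
    have "t * (y + q * 2 ^ (n + 2))\<^sup>2 - u = 2 ^ (n + 3) * (q * (1 + t * y) + t * q\<^sup>2 * 2 ^ (n + 1))"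
      using q by (simp add: power2_eq_square power_add algebra_simps)
    also have "\<dots> = 2 ^ (Suc n + 3) * (r + t * q\<^sup>2 * 2 ^ n)"
      unfolding r by (simp add: power_add algebra_simps)
    finally have "[t * (y + q * 2 ^ (n + 2))\<^sup>2 = u] (mod 2 ^ (Suc n + 3))"
      by (simp add: cong_iff_dvd_diff)
    moreover have "odd (y + q * 2 ^ (n + 2))" using y(1) by simp
    ultimately show ?case by blast
  qed
  then show ?thesis by (meson cong_dvd_modulus le_add1 le_imp_power_dvd)
qed

lemma represented_2_lift:
  assumes "odd c" "odd z" "[diag_form a b c x y z = l] (mod 8)"
  shows "represented (diag_form a b c) (2 ^ e) l"
proof -
  have "[c * z\<^sup>2 = l - a * x\<^sup>2 - b * y\<^sup>2] (mod 8)"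
    using assms(3) by (simp add: cong_iff_dvd_diff diag_form_def algebra_simps)
  from hensel_square_2[OF assms(1,2) this, of e] obtain w
    where "[c * w\<^sup>2 = l - a * x\<^sup>2 - b * y\<^sup>2] (mod 2 ^ e)" by blast
  then have "[diag_form a b c x y w = l] (mod 2 ^ e)"
    by (simp add: cong_iff_dvd_diff diag_form_def algebra_simps)
  then show ?thesis by (rule representedI)
qed

text \<open>Writing \<open>a = 2 * t\<close> and halving costs a factor 2 of the modulus: a
  congruence modulo 16 leaves one modulo 8 for the odd coefficient \<open>t\<close>.\<close>

lemma represented_2_lift_double:
  assumes "[a = 2] (mod 4)" "odd x" "[diag_form a b c x y z = l] (mod 16)"
  shows "represented (diag_form a b c) (2 ^ e) l"
proof -
  define t where "t = a div 2"
  have "a mod 4 = 2" using assms(1) by (simp add: cong_def)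
  then have "even a" "odd t" unfolding t_def by (presburger, presburger)
  then have t: "a = 2 * t" "odd t" by (simp_all add: t_def)
  \<comment> \<open>With the exact quotient \<open>k\<close> the equation can be halved over the
    integers.\<close>
  obtain k where "diag_form a b c x y z - l = 16 * k"
    using assms(3) by (auto simp: cong_iff_dvd_diff)
  then have k: "l - b * y\<^sup>2 - c * z\<^sup>2 = 2 * (t * x\<^sup>2 - 8 * k)"
    by (simp add: diag_form_def t algebra_simps)
  have "[t * x\<^sup>2 = t * x\<^sup>2 - 8 * k] (mod 8)" by (simp add: cong_iff_dvd_diff)
  from hensel_square_2[OF t(2) assms(2) this, of e] obtain w
    where "[t * w\<^sup>2 = t * x\<^sup>2 - 8 * k] (mod 2 ^ e)" by blast
  then have "[2 * (t * w\<^sup>2) = l - b * y\<^sup>2 - c * z\<^sup>2] (mod 2 ^ e)"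
    unfolding k by (rule cong_scalar_left)
  then have "[diag_form a b c w y z = l] (mod 2 ^ e)"
    by (simp add: cong_iff_dvd_diff diag_form_def t algebra_simps)
  then show ?thesis by (rule representedI)
qed

lemma represented_mult_4:
  assumes "represented (diag_form a b c) k l"
  shows "represented (diag_form a b c) k (4 * l)"
proof -
  obtain x y z where "[diag_form a b c x y z = l] (mod k)"
    using assms by (auto simp: represented_def)
  then have "[4 * diag_form a b c x y z = 4 * l] (mod k)" by (rule cong_scalar_left)
  then have "[diag_form a b c (2 * x) (2 * y) (2 * z) = 4 * l] (mod k)"
    by (simp add: diag_form_def power2_eq_square algebra_simps)
  then show ?thesis by (rule representedI)
qed

section \<open>Finite search over residues modulo 4, 8 and 16\<close>

lemma square_cong_4: "\<exists>X\<in>set [0, 1]. [x\<^sup>2 = X] (mod 4)" for x :: int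
proof -
  have "[x\<^sup>2 = (x mod 4)\<^sup>2] (mod 4)" by (simp add: cong_def power_mod)
  moreover have "x mod 4 \<in> set [0..3]" by simp
  ultimately show ?thesis by (auto simp: upto.simps cong_def)
qed

lemma square_cong_8: "\<exists>X\<in>set [0, 1, 4]. [x\<^sup>2 = X] (mod 8)" for x :: int
proof -
  have "[x\<^sup>2 = (x mod 8)\<^sup>2] (mod 8)" by (simp add: cong_def power_mod)
  moreover have "x mod 8 \<in> set [0..7]" by simp
  ultimately show ?thesis by (auto simp: upto.simps cong_def)
qed

lemma square_cong_16: "\<exists>X\<in>set [0, 1, 4, 9]. [x\<^sup>2 = X] (mod 16)" for x :: int
proof -
  have "[x\<^sup>2 = (x mod 16)\<^sup>2] (mod 16)" by (simp add: cong_def power_mod)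
  moreover have "x mod 16 \<in> set [0..15]" by simp
  ultimately show ?thesis by (auto simp: upto.simps cong_def)
qed

text \<open>\<open>X\<close>, \<open>Y\<close>, \<open>Z\<close> stand for squares, taken from the
  list \<open>S\<close> of square residues. Explicit lists make the search executable by
  \<open>code_simp\<close>.\<close>

definition obstructed :: "int \<Rightarrow> int list \<Rightarrow> int \<Rightarrow> int \<Rightarrow> int \<Rightarrow> bool" where
  "obstructed k S a b c \<longleftrightarrow>
     (\<exists>l\<in>set [0..k-1]. \<forall>X\<in>set S. \<forall>Y\<in>set S. \<forall>Z\<in>set S. (a * X + b * Y + c * Z) mod k \<noteq> l)"

lemma local_obstruction_if_obstructed:
  assumes "\<And>x::int. \<exists>X\<in>set S. [x\<^sup>2 = X] (mod k)" and "obstructed k S (a mod k) (b mod k) (c mod k)"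
  shows "local_obstruction (diag_form a b c) k"
proof -
  obtain l where l: "l \<in> set [0..k-1]"
    "\<And>X Y Z. X \<in> set S \<Longrightarrow> Y \<in> set S \<Longrightarrow> Z \<in> set S \<Longrightarrow>
      ((a mod k) * X + (b mod k) * Y + (c mod k) * Z) mod k \<noteq> l"
    using assms(2) unfolding obstructed_def by blast
  have "\<not> [diag_form a b c x y z = l] (mod k)" for x y z
  proof
    assume *: "[diag_form a b c x y z = l] (mod k)"
    obtain X Y Z where XYZ: "X \<in> set S" "Y \<in> set S" "Z \<in> set S"
      and "[x\<^sup>2 = X] (mod k)" "[y\<^sup>2 = Y] (mod k)" "[z\<^sup>2 = Z] (mod k)"
      using assms(1) by metis
    then have "[diag_form a b c x y z = (a mod k) * X + (b mod k) * Y + (c mod k) * Z] (mod k)"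
      unfolding diag_form_def by (intro cong_add cong_mult) auto
    then have "((a mod k) * X + (b mod k) * Y + (c mod k) * Z) mod k = l"
      using * l(1) by (simp add: cong_def)
    then show False using l(2) XYZ by blast
  qed
  then show ?thesis unfolding local_obstruction_def by blast
qed

text \<open>0, 1, 2 already produce every square modulo 4 and modulo 8, where this is
  applied.\<close>

definition solvable :: "int \<Rightarrow> int \<Rightarrow> int \<Rightarrow> int \<Rightarrow> int \<Rightarrow> bool" where
  "solvable k a b c l \<longleftrightarrow>
     (\<exists>x\<in>set [0..2]. \<exists>y\<in>set [0..2]. \<exists>z\<in>set [0..2]. diag_form a b c x y z mod k = l)"

text \<open>The bound 3 adds the square class 9 modulo 16. An odd variable is what the lifting
  lemmas start from.\<close>

definition primitively_solvable :: "int \<Rightarrow> int \<Rightarrow> int \<Rightarrow> int \<Rightarrow> int \<Rightarrow> bool" where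
  "primitively_solvable k a b c l \<longleftrightarrow>
     (\<exists>x\<in>set [0..3]. \<exists>y\<in>set [0..3]. \<exists>z\<in>set [0..3].
        (odd x \<or> odd y \<or> odd z) \<and> diag_form a b c x y z mod k = l)"

lemma cong_diag_form_mod:
  "[diag_form (a mod k) (b mod k) (c mod k) x y z = diag_form a b c x y z] (mod k)"
  unfolding diag_form_def by (intro cong_add cong_mult) auto

lemma not_local_obstruction_if_solvable:
  assumes "k > 0" "\<forall>l\<in>set [0..k-1]. solvable k (a mod k) (b mod k) (c mod k) l"
  shows "\<not> local_obstruction (diag_form a b c) k"
proof -
  have "represented (diag_form a b c) k l" for l
  proof -
    have "l mod k \<in> set [0..k-1]" using assms(1) by simp
    then obtain x y z where "diag_form (a mod k) (b mod k) (c mod k) x y z mod k = l mod k"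
      using assms(2) unfolding solvable_def by blast
    then have "[diag_form a b c x y z = l] (mod k)"
      using cong_diag_form_mod[of a k b c x y z] by (simp add: cong_def)
    then show ?thesis by (rule representedI)
  qed
  then show ?thesis by (simp add: local_obstruction_iff)
qed

lemma primitively_solvableE:
  assumes "primitively_solvable k (a mod k) (b mod k) (c mod k) (l mod k)"
  obtains x y z where "odd x \<or> odd y \<or> odd z" "[diag_form a b c x y z = l] (mod k)"
proof -
  obtain x y z where "odd x \<or> odd y \<or> odd z" "diag_form (a mod k) (b mod k) (c mod k) x y z mod k = l mod k"
    using assms unfolding primitively_solvable_def by blast
  moreover from this have "[diag_form a b c x y z = l] (mod k)"
    using cong_diag_form_mod[of a k b c x y z] by (simp add: cong_def)
  ultimately show ?thesis using that by blast
qed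

text \<open>Transfers the case conditions, which are modulo 4 and 8, to the residues modulo 8 and 16
  that are searched.\<close>

lemma mod_mod_cancel_pow2:
  fixes a b c :: int
  shows "a mod 8 mod 4 = a mod 4" "a mod 16 mod 4 = a mod 4" "a mod 16 mod 8 = a mod 8"
    "(b mod 16 + c mod 16) mod 8 = (b + c) mod 8"
    "(a mod 16 + b mod 16 + c mod 16) mod 8 = (a + b + c) mod 8"
proof -
  show *: "a mod 8 mod 4 = a mod 4" "a mod 16 mod 4 = a mod 4" "a mod 16 mod 8 = a mod 8" for a :: int
    by (simp_all add: mod_mod_cancel)
  show "(b mod 16 + c mod 16) mod 8 = (b + c) mod 8"
    "(a mod 16 + b mod 16 + c mod 16) mod 8 = (a + b + c) mod 8"
    by (metis * mod_add_eq)+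
qed

lemma odd_residues:
  fixes a :: int
  assumes "odd a"
  shows "a mod 4 \<in> set [1, 3]" "a mod 8 \<in> set [1, 3, 5, 7]"
    "a mod 16 \<in> set [1, 3, 5, 7, 9, 11, 13, 15]"
proof -
  have "odd (a mod 4)" "odd (a mod 8)" "odd (a mod 16)" using assms by (simp_all add: dvd_mod_iff)
  moreover have "a mod 4 \<in> set [0..3]" "a mod 8 \<in> set [0..7]" "a mod 16 \<in> set [0..15]" by simp_all
  moreover have "\<forall>r\<in>set [0..3]. odd r \<longrightarrow> r \<in> set [1, 3 :: int]"
    "\<forall>r\<in>set [0..7]. odd r \<longrightarrow> r \<in> set [1, 3, 5, 7 :: int]"
    "\<forall>r\<in>set [0..15]. odd r \<longrightarrow> r \<in> set [1, 3, 5, 7, 9, 11, 13, 15 :: int]"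
    by code_simp+
  ultimately show "a mod 4 \<in> set [1, 3]" "a mod 8 \<in> set [1, 3, 5, 7]"
      "a mod 16 \<in> set [1, 3, 5, 7, 9, 11, 13, 15]"
    by blast+
qed

lemma two_mod_four_residues:
  fixes a :: int
  assumes "[a = 2] (mod 4)"
  shows "a mod 8 \<in> set [2, 6]" "a mod 16 \<in> set [2, 6, 10, 14]"
proof -
  have "a mod 8 mod 4 = 2" "a mod 16 mod 4 = 2"
    using assms unfolding mod_mod_cancel_pow2 by (simp_all add: cong_def)
  moreover have "a mod 8 \<in> set [0..7]" "a mod 16 \<in> set [0..15]" by simp_all
  moreover have "\<forall>r\<in>set [0..7]. r mod 4 = 2 \<longrightarrow> r \<in> set [2, 6 :: int]"
    "\<forall>r\<in>set [0..15]. r mod 4 = 2 \<longrightarrow> r \<in> set [2, 6, 10, 14 :: int]"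
    by code_simp+
  ultimately show "a mod 8 \<in> set [2, 6]" "a mod 16 \<in> set [2, 6, 10, 14]"
    by blast+
qed

section \<open>Obstructions modulo 4, 8 and 16\<close>

text \<open>A value congruent to \<open>a + b + c\<close> modulo 4 forces all variables odd, hence
  agrees with \<open>a + b + c\<close> modulo 8; so \<open>a + b + c + 4\<close> is missed.\<close>

lemma local_obstruction_8_all_odd:
  assumes "odd a" "odd b" "odd c" "[a = b] (mod 4)" "[b = c] (mod 4)"
  shows "local_obstruction (diag_form a b c) 8"
proof (rule local_obstruction_if_obstructed[OF square_cong_8])
  have "\<forall>a\<in>set [1, 3, 5, 7]. \<forall>b\<in>set [1, 3, 5, 7]. \<forall>c\<in>set [1, 3, 5, 7].
      a mod 4 = b mod 4 \<longrightarrow> b mod 4 = c mod 4 \<longrightarrow> obstructed 8 [0, 1, 4] a b c"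
    by code_simp
  moreover have "a mod 8 mod 4 = b mod 8 mod 4" "b mod 8 mod 4 = c mod 8 mod 4"
    using assms(4,5) unfolding mod_mod_cancel_pow2 cong_def .
  ultimately show "obstructed 8 [0, 1, 4] (a mod 8) (b mod 8) (c mod 8)"
    using assms(1-3) odd_residues(2) by blast
qed

lemma local_obstruction_4_two_divisible:
  assumes "4 dvd a" "4 dvd b" "odd c"
  shows "local_obstruction (diag_form a b c) 4"
proof (rule local_obstruction_if_obstructed[OF square_cong_4])
  have "\<forall>c\<in>set [1, 3]. obstructed 4 [0, 1] 0 0 c" by code_simp
  then show "obstructed 4 [0, 1] (a mod 4) (b mod 4) (c mod 4)"
    using assms odd_residues(1) by (metis mod_eq_0_iff_dvd)
qed

text \<open>\<open>b * y^2 + c * z^2\<close> misses \<open>3 * b\<close> modulo 4 if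
  \<open>b\<close> and \<open>c\<close> agree modulo 4, and misses 2 otherwise.\<close>

lemma local_obstruction_4_one_divisible:
  assumes "4 dvd a" "odd b" "odd c"
  shows "local_obstruction (diag_form a b c) 4"
proof (rule local_obstruction_if_obstructed[OF square_cong_4])
  have "\<forall>b\<in>set [1, 3]. \<forall>c\<in>set [1, 3]. obstructed 4 [0, 1] 0 b c" by code_simp
  then show "obstructed 4 [0, 1] (a mod 4) (b mod 4) (c mod 4)"
    using assms odd_residues(1) by (metis mod_eq_0_iff_dvd)
qed

text \<open>Odd values are \<open>c\<close>, \<open>c + a\<close>, \<open>c + b\<close> or
  \<open>c + a + b\<close> modulo 8, and two of these coincide, so an odd class is missed.\<close>

lemma local_obstruction_8_two_even:
  assumes "[a = 2] (mod 4)" "[b = 2] (mod 4) \<or> [b = 0] (mod 8)" "odd c"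
  shows "local_obstruction (diag_form a b c) 8"
proof (rule local_obstruction_if_obstructed[OF square_cong_8])
  have "\<forall>a\<in>set [2, 6]. \<forall>b\<in>set [0, 2, 6]. \<forall>c\<in>set [1, 3, 5, 7]. obstructed 8 [0, 1, 4] a b c"
    by code_simp
  moreover have "b mod 8 \<in> set [0, 2, 6]"
    using assms(2) two_mod_four_residues(1)[of b] by (auto simp: cong_def)
  ultimately show "obstructed 8 [0, 1, 4] (a mod 8) (b mod 8) (c mod 8)"
    using assms odd_residues(2) two_mod_four_residues(1) by blast
qed

text \<open>A value that is 2 modulo 4 needs \<open>x\<close> odd and \<open>z\<close> even, so it
  is \<open>a\<close>, \<open>a + b\<close>, \<open>a + 4 * c\<close> or
  \<open>a + b + 4 * c\<close> modulo 16. Both \<open>b\<close> and \<open>4 * c\<close> are 4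
  modulo 8, so two of these coincide and a class is missed.\<close>

lemma local_obstruction_16_two_even:
  assumes "[a = 2] (mod 4)" "[b = 4] (mod 8)" "odd c"
  shows "local_obstruction (diag_form a b c) 16"
proof (rule local_obstruction_if_obstructed[OF square_cong_16])
  have "\<forall>a\<in>set [2, 6, 10, 14]. \<forall>b\<in>set [4, 12]. \<forall>c\<in>set [1, 3, 5, 7, 9, 11, 13, 15].
      obstructed 16 [0, 1, 4, 9] a b c"
    by code_simp
  moreover have "b mod 16 \<in> set [4, 12]"
  proof -
    have "b mod 8 = 4" using assms(2) by (simp add: cong_def)
    then show ?thesis by simp presburger
  qed
  ultimately show "obstructed 16 [0, 1, 4, 9] (a mod 16) (b mod 16) (c mod 16)"
    using assms odd_residues(3) two_mod_four_residues(2) by blast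
qed

text \<open>The missed class is again 2 modulo 4: it is \<open>a + 12 * b\<close> if
  \<open>b + c\<close> is 2 modulo 4, and \<open>a + 8\<close> if \<open>b + c\<close> is 4 modulo
  8.\<close>

lemma local_obstruction_16_one_even:
  assumes "[a = 2] (mod 4)" "odd b" "odd c"
    and "\<not> [a + b + c = 0] (mod 8)" "\<not> [b + c = 0] (mod 8)"
  shows "local_obstruction (diag_form a b c) 16"
proof (rule local_obstruction_if_obstructed[OF square_cong_16])
  have "\<forall>a\<in>set [2, 6, 10, 14]. \<forall>b\<in>set [1, 3, 5, 7, 9, 11, 13, 15].
      \<forall>c\<in>set [1, 3, 5, 7, 9, 11, 13, 15].
      (a + b + c) mod 8 \<noteq> 0 \<longrightarrow> (b + c) mod 8 \<noteq> 0 \<longrightarrow> obstructed 16 [0, 1, 4, 9] a b c"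
    by code_simp
  moreover have "(a mod 16 + b mod 16 + c mod 16) mod 8 \<noteq> 0" "(b mod 16 + c mod 16) mod 8 \<noteq> 0"
    using assms(4,5) unfolding mod_mod_cancel_pow2 by (simp_all add: cong_def)
  ultimately show "obstructed 16 [0, 1, 4, 9] (a mod 16) (b mod 16) (c mod 16)"
    using assms(1-3) odd_residues(3) two_mod_four_residues(2) by blast
qed

section \<open>Absence of obstructions modulo 2, 4 and 8\<close>

lemma not_local_obstruction_2:
  assumes "odd c"
  shows "\<not> local_obstruction (diag_form a b c) 2"
proof -
  have "[diag_form a b c 0 0 l = l] (mod 2)" for l
    using assms by (simp add: cong_iff_dvd_diff diag_form_def)
  then show ?thesis using representedI by (metis local_obstruction_iff)
qed

text \<open>Setting zero to three variables to 1 and the others to 0 gives \<open>0\<close>,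
  \<open>a\<close>, \<open>2 * a\<close>, \<open>3 * a\<close> modulo 4.\<close>

lemma not_local_obstruction_4_all_odd:
  assumes "odd a" "[a = b] (mod 4)" "[b = c] (mod 4)"
  shows "\<not> local_obstruction (diag_form a b c) 4"
proof (rule not_local_obstruction_if_solvable)
  have "\<forall>a\<in>set [1, 3]. \<forall>l\<in>set [0..4-1]. solvable 4 a a a l" by code_simp
  then show "\<forall>l\<in>set [0..4-1]. solvable 4 (a mod 4) (b mod 4) (c mod 4) l"
    using assms odd_residues(1) by (metis cong_def)
qed simp

lemma not_local_obstruction_4_two_even:
  assumes "[a = 2] (mod 4)" "even b" "odd c"
  shows "\<not> local_obstruction (diag_form a b c) 4"
proof (rule not_local_obstruction_if_solvable)
  have "\<forall>b\<in>set [0, 2]. \<forall>c\<in>set [1, 3]. \<forall>l\<in>set [0..4-1]. solvable 4 2 b c l" by code_simp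
  moreover have "b mod 4 \<in> set [0, 2]" using assms(2) by simp presburger
  moreover have "a mod 4 = 2" using assms(1) by (simp add: cong_def)
  ultimately show "\<forall>l\<in>set [0..4-1]. solvable 4 (a mod 4) (b mod 4) (c mod 4) l"
    using assms(3) odd_residues(1) by metis
qed simp

text \<open>The disjunction on \<open>b\<close> serves both cases with value 4: one even coefficient
  and two even coefficients.\<close>

lemma not_local_obstruction_8:
  assumes "[a = 2] (mod 4)" "odd b \<or> [b = 4] (mod 8)" "odd c"
  shows "\<not> local_obstruction (diag_form a b c) 8"
proof (rule not_local_obstruction_if_solvable)
  have "\<forall>a\<in>set [2, 6]. \<forall>b\<in>set [1, 3, 4, 5, 7]. \<forall>c\<in>set [1, 3, 5, 7]. \<forall>l\<in>set [0..8-1]. solvable 8 a b c l"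
    by code_simp
  moreover have "b mod 8 \<in> set [1, 3, 4, 5, 7]"
    using assms(2) odd_residues(2)[of b] by (auto simp: cong_def)
  ultimately show "\<forall>l\<in>set [0..8-1]. solvable 8 (a mod 8) (b mod 8) (c mod 8) l"
    using assms(1,3) odd_residues(2) two_mod_four_residues(1) by blast
qed simp

section \<open>Forms without obstruction at 2\<close>

text \<open>The search finds a solution with an odd variable in every class modulo 8; as all
  coefficients are odd, any odd variable lifts.\<close>

lemma eps_2_all_odd_universal:
  assumes "odd a" "odd b" "odd c" and "\<not> ([a = b] (mod 4) \<and> [b = c] (mod 4))"
  shows "eps (diag_form a b c) 2 = \<infinity>"
proof (rule eps_eq_infinityI)
  fix e l
  have *: "\<forall>a\<in>set [1, 3, 5, 7]. \<forall>b\<in>set [1, 3, 5, 7]. \<forall>c\<in>set [1, 3, 5, 7].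
      a mod 4 = b mod 4 \<and> b mod 4 = c mod 4 \<or> (\<forall>l\<in>set [0..7]. primitively_solvable 8 a b c l)"
    by code_simp
  have "l mod 8 \<in> set [0..7]" by simp
  moreover have "\<not> (a mod 8 mod 4 = b mod 8 mod 4 \<and> b mod 8 mod 4 = c mod 8 mod 4)"
    using assms(4) unfolding mod_mod_cancel_pow2 cong_def .
  ultimately have "primitively_solvable 8 (a mod 8) (b mod 8) (c mod 8) (l mod 8)"
    using * assms(1-3) odd_residues(2) by blast
  then obtain x y z where odd: "odd x \<or> odd y \<or> odd z" and c: "[diag_form a b c x y z = l] (mod 8)"
    by (rule primitively_solvableE)
  \<comment> \<open>The lifting lemma acts on the last variable, so the odd one is moved
    there.\<close>
  have c': "[diag_form a c b x z y = l] (mod 8)" "[diag_form c b a z y x = l] (mod 8)"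
    using c by (simp_all add: diag_form_def algebra_simps)
  from odd show "represented (diag_form a b c) (2 ^ e) l"
  proof (elim disjE)
    assume "odd x"
    then have "represented (diag_form c b a) (2 ^ e) l"
      using represented_2_lift assms(1) c'(2) by blast
    then show ?thesis by (metis represented_perm)
  next
    assume "odd y"
    then have "represented (diag_form a c b) (2 ^ e) l"
      using represented_2_lift assms(2) c'(1) by blast
    then show ?thesis by (metis represented_perm)
  next
    assume "odd z"
    then show ?thesis using represented_2_lift assms(3) c by blast
  qed
qed

text \<open>The odd variable found may be \<open>x\<close>, whose coefficient is 2 modulo 4, so the
  search runs modulo 16. It covers all \<open>l\<close> not congruent to 4 modulo 8, and scaling by
  4 gives the rest.\<close>

lemma eps_2_one_even_universal:
  assumes "[a = 2] (mod 4)" "odd b" "odd c"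
    and "[a + b + c = 0] (mod 8) \<or> [b + c = 0] (mod 8)"
  shows "eps (diag_form a b c) 2 = \<infinity>"
proof (rule eps_eq_infinityI)
  fix e l
  have *: "represented (diag_form a b c) (2 ^ e) l" if l: "l mod 8 \<noteq> 4" for l
  proof -
    have *: "\<forall>a\<in>set [2, 6, 10, 14]. \<forall>b\<in>set [1, 3, 5, 7, 9, 11, 13, 15].
        \<forall>c\<in>set [1, 3, 5, 7, 9, 11, 13, 15]. (a + b + c) mod 8 = 0 \<or> (b + c) mod 8 = 0 \<longrightarrow>
        (\<forall>l\<in>set [0..15]. l mod 8 = 4 \<or> primitively_solvable 16 a b c l)"
      by code_simp
    have "(a mod 16 + b mod 16 + c mod 16) mod 8 = 0 \<or> (b mod 16 + c mod 16) mod 8 = 0"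
      using assms(4) unfolding mod_mod_cancel_pow2 by (simp add: cong_def)
    moreover have "l mod 16 \<in> set [0..15]" by simp
    ultimately have "l mod 16 mod 8 = 4 \<or>
        primitively_solvable 16 (a mod 16) (b mod 16) (c mod 16) (l mod 16)"
      by (rule *[rule_format, OF two_mod_four_residues(2)[OF assms(1)] odd_residues(3)[OF assms(2)]
          odd_residues(3)[OF assms(3)]])
    then have "primitively_solvable 16 (a mod 16) (b mod 16) (c mod 16) (l mod 16)"
      using l by (simp add: mod_mod_cancel_pow2)
    then obtain x y z where odd: "odd x \<or> odd y \<or> odd z"
      and c: "[diag_form a b c x y z = l] (mod 16)"
      by (rule primitively_solvableE)
    \<comment> \<open>Modulus 8 suffices when \<open>y\<close> or \<open>z\<close> is odd, since
      \<open>b\<close> and \<open>c\<close> are odd.\<close>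
    have c8: "[diag_form a b c x y z = l] (mod 8)" using c by (rule cong_dvd_modulus) simp
    have c8': "[diag_form a c b x z y = l] (mod 8)"
      using c8 by (simp add: diag_form_def algebra_simps)
    from odd show ?thesis
    proof (elim disjE)
      assume "odd x"
      then show ?thesis using represented_2_lift_double assms(1) c by blast
    next
      assume "odd y"
      then have "represented (diag_form a c b) (2 ^ e) l"
        using represented_2_lift assms(2) c8' by blast
      then show ?thesis by (metis represented_perm)
    next
      assume "odd z"
      then show ?thesis using represented_2_lift assms(3) c8 by blast
    qed
  qed
  show "represented (diag_form a b c) (2 ^ e) l"
  proof (cases "l mod 8 = 4")
    case True
    \<comment> \<open>A solution need not be primitive here, but \<open>l div 4\<close> is odd.\<close>
    then have "l = 4 * (l div 4)" "(l div 4) mod 8 \<noteq> 4" by presburger+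
    then show ?thesis using * represented_mult_4 by metis
  qed (use * in blast)
qed

section \<open>Assembly of the cases\<close>

lemma eps_2_eqI:
  "local_obstruction Q 4 \<Longrightarrow> \<not> local_obstruction Q 2 \<Longrightarrow> eps Q 2 = 2"
  "local_obstruction Q 8 \<Longrightarrow> \<not> local_obstruction Q 4 \<Longrightarrow> eps Q 2 = 3"
  "local_obstruction Q 16 \<Longrightarrow> \<not> local_obstruction Q 8 \<Longrightarrow> eps Q 2 = 4"
  using eps_eq_SucI[of Q 2 1] eps_eq_SucI[of Q 2 2] eps_eq_SucI[of Q 2 3]
  by (simp_all add: numeral_eq_enat eval_nat_numeral)

lemma num_divisible_eq:
  "num_divisible p a b c = of_bool (p dvd a) + of_bool (p dvd b) + of_bool (p dvd c)"
  by (simp add: num_divisible_def)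

theorem theorem1p5:
  fixes a\<^sub>0 b\<^sub>0 c\<^sub>0 a b c p :: int and Q :: "int \<Rightarrow> int \<Rightarrow> int \<Rightarrow> int"
  assumes pos: "a\<^sub>0 > 0" "b\<^sub>0 > 0" "c\<^sub>0 > 0"
    and coprime: "Gcd {a\<^sub>0, b\<^sub>0, c\<^sub>0} = 1"
    and Q: "Q = diag_form a\<^sub>0 b\<^sub>0 c\<^sub>0"
    and p: "prime p"
    and labelling: "{#a, b, c#} = {#a\<^sub>0, b\<^sub>0, c\<^sub>0#}" "labelled p a b c"
  shows
    "(odd p \<longrightarrow>
        (num_divisible p a b c = 2 \<longrightarrow> eps Q p = 1) \<and>
        (num_divisible p a b c = 1 \<and> Legendre (- b * c) p = -1 \<longrightarrow> eps Q p = 2) \<and>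
        (\<not> p dvd a * b * c \<or> num_divisible p a b c = 1 \<and> Legendre (- b * c) p = 1
           \<longrightarrow> eps Q p = \<infinity>))
     \<and> (p = 2 \<longrightarrow>
        (odd a \<and> odd b \<and> odd c \<longrightarrow>
           eps Q 2 = (if [a = b] (mod 4) \<and> [b = c] (mod 4) then 3 else \<infinity>)) \<and>
        (even a \<and> even b \<and> odd c \<longrightarrow>
           (4 dvd a \<and> 4 dvd b \<longrightarrow> eps Q 2 = 2) \<and>
           ([a = 2] (mod 4) \<and> [b = 2] (mod 4) \<or> [a = 2] (mod 4) \<and> [b = 0] (mod 8)
              \<longrightarrow> eps Q 2 = 3) \<and>
           ([a = 2] (mod 4) \<and> [b = 4] (mod 8) \<longrightarrow> eps Q 2 = 4)) \<and>
        (even a \<and> odd b \<and> odd c \<longrightarrow>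
           eps Q 2 =
             (if 4 dvd a then 2
              else if [a = 2] (mod 4) \<and> [a + b + c = 0] (mod 8)
                    \<or> [a = 2] (mod 4) \<and> [b + c = 0] (mod 8) then \<infinity>
              else 4)))"
proof (intro conjI impI)
  have eq: "eps Q q = eps (diag_form a b c) q" for q
    unfolding Q using eps_mset_cong[OF labelling(1)] by simp
  have lab: "p dvd a" if "odd p" "num_divisible p a b c = 1"
    using labelling(2) that by (cases "p = 2") (simp_all add: labelled_def)
  {
    assume "odd p" and num: "num_divisible p a b c = 2"
    \<comment> \<open>For odd \<open>p\<close> the labelling does not say which two coefficients are
      divisible; permutation invariance reduces every pair to the first two.\<close>
    then have "p dvd a \<and> p dvd b \<or> p dvd a \<and> p dvd c \<or> p dvd b \<and> p dvd c"
      by (cases "p dvd a"; cases "p dvd b"; cases "p dvd c"; simp add: num_divisible_eq)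
    then show "eps Q p = 1"
      unfolding eq using eps_odd_two_divisible[OF p \<open>odd p\<close>] eps_perm by metis
  next
    assume "odd p" and num: "num_divisible p a b c = 1 \<and> Legendre (- b * c) p = -1"
    then have "p dvd a" using lab by blast
    then show "eps Q p = 2" unfolding eq using eps_odd_anisotropic p \<open>odd p\<close> num by blast
  next
    assume "odd p" and "\<not> p dvd a * b * c \<or> num_divisible p a b c = 1 \<and> Legendre (- b * c) p = 1"
    then have "\<not> p dvd a \<and> \<not> p dvd b \<and> \<not> p dvd c \<or> p dvd a \<and> Legendre (- b * c) p = 1"
      using lab by (metis dvd_mult dvd_mult2)
    then show "eps Q p = \<infinity>"
      unfolding eq using eps_odd_unit[OF p \<open>odd p\<close>] eps_odd_isotropic[OF p \<open>odd p\<close>] by blast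
  next
    assume "odd a \<and> odd b \<and> odd c"
    then show "eps Q 2 = (if [a = b] (mod 4) \<and> [b = c] (mod 4) then 3 else \<infinity>)"
      unfolding eq using eps_2_all_odd_universal local_obstruction_8_all_odd
        not_local_obstruction_4_all_odd eps_2_eqI(2) by simp
  next
    assume "even a \<and> even b \<and> odd c" "4 dvd a \<and> 4 dvd b"
    then show "eps Q 2 = 2"
      unfolding eq using local_obstruction_4_two_divisible not_local_obstruction_2 eps_2_eqI(1) by blast
  next
    assume "even a \<and> even b \<and> odd c"
      "[a = 2] (mod 4) \<and> [b = 2] (mod 4) \<or> [a = 2] (mod 4) \<and> [b = 0] (mod 8)"
    then show "eps Q 2 = 3"
      unfolding eq using local_obstruction_8_two_even not_local_obstruction_4_two_even eps_2_eqI(2) by blast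
  next
    assume "even a \<and> even b \<and> odd c" "[a = 2] (mod 4) \<and> [b = 4] (mod 8)"
    then show "eps Q 2 = 4"
      unfolding eq using local_obstruction_16_two_even not_local_obstruction_8 eps_2_eqI(3) by blast
  next
    assume *: "even a \<and> odd b \<and> odd c"
    show "eps Q 2 =
             (if 4 dvd a then 2
              else if [a = 2] (mod 4) \<and> [a + b + c = 0] (mod 8)
                    \<or> [a = 2] (mod 4) \<and> [b + c = 0] (mod 8) then \<infinity>
              else 4)"
    proof (cases "4 dvd a")
      case True
      then show ?thesis
        unfolding eq using * local_obstruction_4_one_divisible not_local_obstruction_2 eps_2_eqI(1) by simp
    next
      case False
      then have a: "[a = 2] (mod 4)" using * by (simp add: cong_def) presburger
      show ?thesis
      proof (cases "[a + b + c = 0] (mod 8) \<or> [b + c = 0] (mod 8)")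
        case True
        then show ?thesis unfolding eq using * a \<open>\<not> 4 dvd a\<close> eps_2_one_even_universal by auto
      next
        case 2: False
        then have "eps Q 2 = 4"
          unfolding eq using * a local_obstruction_16_one_even not_local_obstruction_8 eps_2_eqI(3) by blast
        then show ?thesis using 2 False by simp
      qed
    qed
  }
qed

end
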